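(* Let $0<\lambda\le 1/2$ and $f=h+\overline{g}\in\Omega_{\mathcal{H}}^0(\lambda)$. Then $f$ is stable harmonic univalent, and also stable harmonic starlike, in $\mathbb{D}$, and $f$ is stable harmonic convex in $\mathbb{D}_{1/2}$. In particular, $f$ is univalent, and also starlike, in $\mathbb{D}$, and is convex in $\mathbb{D}_{1/2}$.
   Context: $\mathbb{D}=\{z\in\mathbb{C}:|z|<1\}$ and $\mathbb{D}_{1/2}=\{z\in\mathbb{C}:|z|<1/2\}$. $\mathcal{H}^0$ is the class of complex-valued harmonic functions $f=h+\overline{g}$ on $\mathbb{D}$, where $h,g$ are analytic on $\mathbb{D}$ with $h(z)=z+\sum_{n\ge2}a_nz^n$ and $g(z)=\sum_{n\ge2}b_nz^n$. For $\lambda>0$, $\Omega_{\mathcal{H}}^0(\lambda)$ is the set of $f=h+\overline{g}\in\mathcal{H}^0$ such that $|h(z)-zh'(z)|<\lambda-|g(z)-zg'(z)|$ for all $z\in\mathbb{D}$. A function is univalent in a disk if it is injective there; a harmonic function is starlike (respectively, convex) in a disk centered at $0$ if it maps that disk onto a domain that is starlike with respect to the origin (respectively, convex). $f=h+\overline{g}$ is stable harmonic univalent (respectively, starlike, convex) in a disk if for every $\zeta\in\mathbb{C}$ with $|\zeta|=1$ the harmonic function $f_\zeta=h+\zeta\overline{g}$ is univalent (respectively, starlike, convex) in that disk. *)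

theory Defs
  imports "HOL-Complex_Analysis.Complex_Analysis"
begin

text \<open>\<open>H0_decomp f h g\<close>: on the unit disk, \<open>f\<close> is the harmonic function with analytic part \<open>h\<close> and
  co-analytic part \<open>g\<close>, normalised by $h(z) = z + \sum_{n\ge 2} a_n z^n$ and
  $g(z) = \sum_{n\ge 2} b_n z^n$. Only the values on the unit disk are relevant; there \<open>h\<close> and \<open>g\<close>
  are uniquely determined by \<open>f\<close>.\<close>

definition H0_decomp ::
  "(complex \<Rightarrow> complex) \<Rightarrow> (complex \<Rightarrow> complex) \<Rightarrow> (complex \<Rightarrow> complex) \<Rightarrow> bool" where
  "H0_decomp f h g \<longleftrightarrow>
     h holomorphic_on ball 0 1 \<and> g holomorphic_on ball 0 1 \<and>
     (\<exists>a. \<forall>z\<in>ball 0 1. (\<lambda>n. a (n + 2) * z ^ (n + 2)) sums (h z - z)) \<and>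
     (\<exists>b. \<forall>z\<in>ball 0 1. (\<lambda>n. b (n + 2) * z ^ (n + 2)) sums g z) \<and>
     (\<forall>z\<in>ball 0 1. f z = h z + cnj (g z))"

definition H0 :: "(complex \<Rightarrow> complex) set" where
  "H0 = {f. \<exists>h g. H0_decomp f h g}"

definition Omega_H0 :: "real \<Rightarrow> (complex \<Rightarrow> complex) set" where
  "Omega_H0 lam = {f \<in> H0. \<exists>h g. H0_decomp f h g \<and>
     (\<forall>z\<in>ball 0 1. cmod (h z - z * deriv h z) < lam - cmod (g z - z * deriv g z))}"

definition domain :: "complex set \<Rightarrow> bool" where
  "domain S \<longleftrightarrow> open S \<and> connected S \<and> S \<noteq> {}"

definition univalent_in_disk :: "real \<Rightarrow> (complex \<Rightarrow> complex) \<Rightarrow> bool" where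
  "univalent_in_disk r f \<longleftrightarrow> inj_on f (ball 0 r)"

text \<open>The library's \<^const>\<open>starlike\<close> leaves the centre of the star unspecified; here it has to be
  the origin.\<close>

definition starlike_in_disk :: "real \<Rightarrow> (complex \<Rightarrow> complex) \<Rightarrow> bool" where
  "starlike_in_disk r f \<longleftrightarrow> domain (f ` ball 0 r) \<and>
     0 \<in> f ` ball 0 r \<and> (\<forall>w\<in>f ` ball 0 r. closed_segment 0 w \<subseteq> f ` ball 0 r)"

definition convex_in_disk :: "real \<Rightarrow> (complex \<Rightarrow> complex) \<Rightarrow> bool" where
  "convex_in_disk r f \<longleftrightarrow> domain (f ` ball 0 r) \<and> convex (f ` ball 0 r)"

definition stable_harmonic ::
  "((complex \<Rightarrow> complex) \<Rightarrow> bool) \<Rightarrow> (complex \<Rightarrow> complex) \<Rightarrow> (complex \<Rightarrow> complex) \<Rightarrow> bool" where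
  "stable_harmonic P h g \<longleftrightarrow> (\<forall>\<zeta>. cmod \<zeta> = 1 \<longrightarrow> P (\<lambda>z. h z + \<zeta> * cnj (g z)))"

end

theory Submission
  imports Defs
begin

text \<open>For $|\epsilon| = 1$ the analytic function $F = h + \epsilon g$ satisfies
  $|F - zF'| < 1/2$. Writing $F = zK$, this is $|z^2 K'| < 1/2$, so $|K'| \le 1/2$ by the maximum
  principle, and the Schwarz--Pick inequality for $K'$ gives $|F''| = |2K' + zK''| \le 1$ for
  $|z| < 1/2$. Letting $\epsilon$ vary turns every bound on $F$ into one on a sum of moduli, such
  as $|h' - 1| + |g'| \le |z|$, which is blind to $\zeta$ in $f = h + \zeta\overline{g}$.
  Thus $f$ is injective, being a perturbation of the identity by a contraction on each smaller
  disk. Starlikeness and convexity come from showing that $|f^{-1}|$ has no interior maximum along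
  a segment from $f(w)$ to $f(z)$ with $|w| \le |z|$, for which it suffices that
  $\mathrm{Re}\,(zh' - \zeta\overline{zg'})\overline{(f(z) - f(w))} > 0$ when $|w| < |z|$;
  for starlikeness only $w = 0$ is needed.\<close>

section \<open>Analytic estimates\<close>

lemma mult_cnj_eq_norm_square: "z * cnj z = (of_real (norm z))\<^sup>2"
  by (metis complex_norm_square of_real_power)

text \<open>Rotating \<open>b\<close> into the direction of \<open>a\<close> gives equality in the
  triangle inequality; \<open>sgn a / sgn b\<close> is that rotation.\<close>

lemma norm_add_le_of_rotations:
  fixes a b :: complex
  assumes "\<And>\<epsilon>. norm \<epsilon> = 1 \<Longrightarrow> norm (a + \<epsilon> * b) \<le> c"
  shows "norm a + norm b \<le> c"
proof (cases "a = 0 \<or> b = 0")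
  case True
  then show ?thesis using assms[of 1] by auto
next
  case False
  define \<epsilon> where "\<epsilon> = sgn a / sgn b"
  have "norm \<epsilon> = 1"
    using False by (simp add: \<epsilon>_def norm_divide norm_sgn)
  moreover have "a + \<epsilon> * b = sgn a * (norm a + norm b)"
    using False by (simp add: \<epsilon>_def sgn_eq field_simps)
  then have "norm (a + \<epsilon> * b) = norm a + norm b"
    using False by (simp add: norm_mult norm_sgn flip: of_real_add)
  ultimately show ?thesis using assms by metis
qed

text \<open>On the circle of radius \<open>r\<close> the hypothesis reads
  \<open>norm (q z) \<le> M / r ^ n\<close>. The maximum principle carries this inward to
  \<open>w\<close>, and letting \<open>r\<close> tend to 1 removes the factor
  \<open>r ^ n\<close>.\<close>

lemma norm_le_of_norm_power_mult_le:
  fixes q :: "complex \<Rightarrow> complex"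
  assumes q: "q holomorphic_on ball 0 1"
    and le: "\<And>z. norm z < 1 \<Longrightarrow> norm (z ^ n * q z) \<le> M"
    and w: "norm w < 1"
  shows "norm (q w) \<le> M"
proof -
  have bd: "r ^ n * norm (q w) \<le> M" if r: "norm w < r" "r < 1" for r
  proof -
    have r0: "0 < r" using r norm_ge_zero[of w] by linarith
    have "norm (q w) \<le> M / r ^ n"
    proof (rule maximum_modulus_frontier[of q "cball 0 r"])
      show "q holomorphic_on interior (cball 0 r)"
        using q by (rule holomorphic_on_subset) (use r in auto)
      show "continuous_on (closure (cball 0 r)) q"
        using holomorphic_on_imp_continuous_on[OF q]
        by (rule continuous_on_subset) (use r in auto)
      show "norm (q z) \<le> M / r ^ n" if "z \<in> frontier (cball 0 r)" for z
        using that le[of z] r r0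
        by (simp add: norm_mult norm_power field_simps)
    qed (use r in auto)
    then show ?thesis using r0 by (simp add: field_simps)
  qed
  have "((\<lambda>r. r ^ n * norm (q w)) \<longlongrightarrow> 1 ^ n * norm (q w)) (at_left 1)"
    by (intro tendsto_intros)
  moreover have "\<forall>\<^sub>F r in at_left 1. r ^ n * norm (q w) \<le> M"
    using eventually_at_left_real[OF w] by eventually_elim (use bd in auto)
  ultimately show ?thesis
    using tendsto_upperbound[of _ "1 ^ n * norm (q w)" "at_left (1::real)"] by simp
qed

text \<open>Composing \<open>f\<close> with Moebius maps that carry 0 to \<open>w\<close> and
  \<open>f w\<close> to 0 gives a self-map \<open>G\<close> of the disk fixing 0. The Schwarz lemma
  bounds \<open>deriv G 0\<close>, and the chain rule expresses it through
  \<open>deriv f w\<close>.\<close>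

lemma Schwarz_Pick_deriv:
  assumes f: "f holomorphic_on ball 0 1"
    and lt: "\<And>z. norm z < 1 \<Longrightarrow> norm (f z) < 1"
    and w: "norm w < 1"
  shows "norm (deriv f w) * (1 - (norm w)\<^sup>2) \<le> 1 - (norm (f w))\<^sup>2"
proof -
  define a where "a = f w"
  have a: "norm a < 1" using lt w by (simp add: a_def)
  have nz: "1 - (norm z)\<^sup>2 > 0" if "norm z < 1" for z :: complex
    using that by (simp add: power_less_one_iff abs_square_less_1)
  define G where "G = Moebius_function 0 a \<circ> (f \<circ> Moebius_function 0 (-w))"
  have wm: "norm (-w) < 1" using w by simp
  have "G holomorphic_on ball 0 1"
    unfolding G_def
    by (intro holomorphic_on_compose_gen[OF _ Moebius_function_holomorphic[OF a]]
        holomorphic_on_compose_gen[OF Moebius_function_holomorphic[OF wm] f])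
      (use lt Moebius_function_norm_lt_1[OF wm] in auto)
  moreover have "G 0 = 0"
    by (simp add: G_def Moebius_function_def a_def)
  moreover have "norm (G z) < 1" if "norm z < 1" for z
    using that lt Moebius_function_norm_lt_1[OF wm] Moebius_function_norm_lt_1[OF a]
    by (simp add: G_def)
  ultimately have "norm (deriv G 0) \<le> 1"
    using Schwarz_Lemma(2)[of G 0] by simp
  moreover have "(G has_field_derivative
      (1 / (1 - (norm a)\<^sup>2)) * (deriv f w * (1 - (norm w)\<^sup>2))) (at 0)"
    unfolding G_def
  proof (intro DERIV_chain)
    have m0: "Moebius_function 0 (-w) 0 = w"
      by (simp add: Moebius_function_def)
    show "(Moebius_function 0 (-w) has_field_derivative (1 - (norm w)\<^sup>2)) (at 0)"
      unfolding Moebius_function_def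
      by (auto intro!: derivative_eq_intros simp: mult_cnj_eq_norm_square)
    show "(f has_field_derivative deriv f w) (at (Moebius_function 0 (-w) 0))"
      unfolding m0 using holomorphic_derivI[OF f open_ball, of w] w by simp
    have ne: "1 - cnj a * a \<noteq> 0"
      using nz[OF a] complex_norm_square[of a]
      by (metis mult.commute of_real_1 of_real_diff of_real_eq_0_iff of_real_power less_irrefl)
    have "(Moebius_function 0 a has_field_derivative 1 / (1 - (norm a)\<^sup>2)) (at a)"
      unfolding Moebius_function_def using ne
      by (auto intro!: derivative_eq_intros simp: mult.commute[of "cnj a"] mult_cnj_eq_norm_square power2_eq_square)
    then show "(Moebius_function 0 a has_field_derivative 1 / (1 - (norm a)\<^sup>2))
       (at ((f \<circ> Moebius_function 0 (-w)) 0))"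
      by (simp add: m0 a_def)
  qed
  then have "deriv G 0 = (1 / (1 - (norm a)\<^sup>2)) * (deriv f w * (1 - (norm w)\<^sup>2))"
    by (rule DERIV_imp_deriv)
  then have "deriv G 0 = deriv f w * of_real ((1 - (norm w)\<^sup>2) / (1 - (norm a)\<^sup>2))"
    by simp
  then have "norm (deriv G 0) = norm (deriv f w) * ((1 - (norm w)\<^sup>2) / (1 - (norm a)\<^sup>2))"
    using nz[OF a] nz[OF w] by (simp only: norm_mult norm_of_real) simp
  ultimately show ?thesis
    using nz[OF a] by (simp add: a_def field_simps)
qed

text \<open>With \<open>\<phi>\<close> the derivative of \<open>K\<close> in
  \<open>F z = z * K z\<close>, the expression is the second derivative of \<open>F\<close>. The two
  summands cannot both be large: by Schwarz--Pick the derivative of \<open>\<phi>\<close> is small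
  where \<open>norm (\<phi> z)\<close> is close to 1/2.\<close>

lemma norm_twice_add_deriv_le:
  assumes \<phi>: "\<phi> holomorphic_on ball 0 1"
    and le: "\<And>z. norm z < 1 \<Longrightarrow> norm (\<phi> z) \<le> 1 / 2"
    and z: "norm z < 1 / 2"
  shows "norm (2 * \<phi> z + z * deriv \<phi> z) \<le> 1"
proof -
  \<comment> \<open>The factor \<open>c\<close> makes the bound on the rescaled function
    \<open>\<psi>\<close> strict, as Schwarz--Pick requires; letting \<open>c\<close> tend to 1
    removes it.\<close>
  have "c * norm (2 * \<phi> z + z * deriv \<phi> z) \<le> 1" if c: "0 < c" "c < 1" for c :: real
  proof -
    define \<psi> where "\<psi> = (\<lambda>z. of_real (2 * c) * \<phi> z)"
    have hol: "\<psi> holomorphic_on ball 0 1"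
      unfolding \<psi>_def using \<phi> by (intro holomorphic_intros)
    have lt: "norm (\<psi> w) < 1" if "norm w < 1" for w
    proof -
      have "norm (\<psi> w) = c * (2 * norm (\<phi> w))"
        using c by (simp add: \<psi>_def norm_mult)
      also have "\<dots> \<le> c * 1" using le[OF that] c by (intro mult_left_mono) auto
      finally show ?thesis using c by simp
    qed
    define x where "x = norm (\<psi> z)"
    have x: "0 \<le> x" "x < 1" using lt z by (auto simp: x_def)
    have d: "deriv \<psi> z = of_real (2 * c) * deriv \<phi> z"
      unfolding \<psi>_def using holomorphic_on_imp_differentiable_at[OF \<phi>, of z] z
      by (intro deriv_cmult) auto
    \<comment> \<open>Here the radius 1/2 enters: 1 - |z|^2 is at least 3/4, whence the constant 4/3
      below.\<close>
    have "(norm z)\<^sup>2 \<le> (1 / 2)\<^sup>2" using z by (intro power_mono) auto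
    then have "norm (deriv \<psi> z) * (3 / 4) \<le> norm (deriv \<psi> z) * (1 - (norm z)\<^sup>2)"
      by (intro mult_left_mono) (auto simp: power2_eq_square)
    also have "\<dots> \<le> 1 - x\<^sup>2"
      unfolding x_def using z by (intro Schwarz_Pick_deriv hol lt) auto
    finally have D: "norm (deriv \<psi> z) \<le> 4 / 3 * (1 - x\<^sup>2)" by simp
    have "2 * (c * norm (2 * \<phi> z + z * deriv \<phi> z)) = norm (2 * \<psi> z + z * deriv \<psi> z)"
    proof -
      have "2 * \<psi> z + z * deriv \<psi> z = of_real (2 * c) * (2 * \<phi> z + z * deriv \<phi> z)"
        by (simp add: d) (simp add: \<psi>_def algebra_simps)
      then show ?thesis using c by (simp add: norm_mult del: of_real_mult)
    qed
    also have "\<dots> \<le> 2 * x + norm z * norm (deriv \<psi> z)"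
      unfolding x_def by (rule norm_triangle_le) (simp add: norm_mult)
    also have "norm z * norm (deriv \<psi> z) \<le> 1 / 2 * (4 / 3 * (1 - x\<^sup>2))"
      using z D by (intro mult_mono) auto
    \<comment> \<open>Right side minus left side is 2/3 times
      \<open>(1 - x) * (2 - x)\<close>.\<close>
    also have "2 * x + 1 / 2 * (4 / 3 * (1 - x\<^sup>2)) \<le> 2"
    proof -
      have "0 \<le> (1 - x) * (2 - x)" using x by (intro mult_nonneg_nonneg) auto
      then show ?thesis using x by (simp add: power2_eq_square field_simps)
    qed
    finally show ?thesis by simp
  qed
  then show ?thesis by (rule field_le_mult_one_interval)
qed

text \<open>All four bounds are read off \<open>K\<close> in \<open>F z = z * K z\<close>. There
  \<open>F z - z * deriv F z\<close> is minus \<open>z\<^sup>2 * deriv K z\<close>, so dividing out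
  the square gives \<open>norm (deriv K z) \<le> 1 / 2\<close>; integrating from
  \<open>K 0 = 1\<close> bounds \<open>K z - 1\<close>. The rest uses F - z = z(K - 1), F' - 1 = (K
  - 1) + zK' and F'' = 2K' + zK''.\<close>

lemma Omega_analytic_bounds:
  assumes F: "F holomorphic_on ball 0 1" and F0: "F 0 = 0" and F1: "deriv F 0 = 1"
    and le: "\<And>z. norm z < 1 \<Longrightarrow> norm (F z - z * deriv F z) \<le> 1 / 2"
    and z: "norm z < 1"
  shows "norm (F z - z * deriv F z) \<le> (norm z)\<^sup>2 / 2"
    and "norm (F z - z) \<le> (norm z)\<^sup>2 / 2"
    and "norm (deriv F z - 1) \<le> norm z"
    and "norm z < 1 / 2 \<Longrightarrow> norm (deriv (deriv F) z) \<le> 1"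
proof -
  obtain K where K: "K holomorphic_on ball 0 1"
    and FK: "\<And>z. norm z < 1 \<Longrightarrow> F z = z * K z" and K0: "K 0 = 1"
    using Schwarz3[OF F F0] F1 by metis
  have K': "deriv K holomorphic_on ball 0 1"
    using K by (rule holomorphic_deriv) simp
  have dK: "(K has_field_derivative deriv K z) (at z)" if "norm z < 1" for z
    using holomorphic_derivI[OF K open_ball, of z] that by simp
  have dK': "(deriv K has_field_derivative deriv (deriv K) z) (at z)" if "norm z < 1" for z
    using holomorphic_derivI[OF K' open_ball, of z] that by simp
  have dF: "deriv F z = K z + z * deriv K z" if "norm z < 1" for z
  proof (rule DERIV_imp_deriv, rule has_field_derivative_transform_within_open[where S = "ball 0 1"])
    show "((\<lambda>z. z * K z) has_field_derivative K z + z * deriv K z) (at z)"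
      using dK[OF that] by (auto intro!: derivative_eq_intros)
  qed (use that FK in auto)
  have ddF: "deriv (deriv F) z = 2 * deriv K z + z * deriv (deriv K) z" if "norm z < 1" for z
  proof (rule DERIV_imp_deriv, rule has_field_derivative_transform_within_open[where S = "ball 0 1"])
    show "((\<lambda>z. K z + z * deriv K z) has_field_derivative
        2 * deriv K z + z * deriv (deriv K) z) (at z)"
      using dK[OF that] dK'[OF that] by (auto intro!: derivative_eq_intros)
  qed (use that dF in auto)
  have FF: "F z - z * deriv F z = - (z\<^sup>2 * deriv K z)" if "norm z < 1" for z
    using that by (simp add: FK dF algebra_simps power2_eq_square)
  have K'le: "norm (deriv K z) \<le> 1 / 2" if "norm z < 1" for z
    using K' _ that
  proof (rule norm_le_of_norm_power_mult_le[where n = 2])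
    show "norm (z\<^sup>2 * deriv K z) \<le> 1 / 2" if "norm z < 1" for z
      using le[OF that] FF[OF that] by simp
  qed
  have Kle: "norm (K z - 1) \<le> norm z / 2"
  proof -
    have "norm (K z - K 0) \<le> 1 / 2 * norm (z - 0)"
      by (rule field_differentiable_bound[where S = "ball 0 1" and f' = "deriv K"])
        (use z dK K'le in \<open>auto intro: has_field_derivative_at_within\<close>)
    then show ?thesis by (simp add: K0)
  qed
  have "(norm z)\<^sup>2 * norm (deriv K z) \<le> (norm z)\<^sup>2 * (1 / 2)"
    using K'le[OF z] by (intro mult_left_mono) auto
  then show "norm (F z - z * deriv F z) \<le> (norm z)\<^sup>2 / 2"
    by (simp add: FF z norm_mult norm_power)
  have "norm z * norm (K z - 1) \<le> norm z * (norm z / 2)"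
    using Kle by (intro mult_left_mono) auto
  moreover have "F z - z = z * (K z - 1)" using z by (simp add: FK algebra_simps)
  ultimately show "norm (F z - z) \<le> (norm z)\<^sup>2 / 2"
    by (simp add: norm_mult power2_eq_square)
  have "norm z * norm (deriv K z) \<le> norm z * (1 / 2)"
    using K'le[OF z] by (intro mult_left_mono) auto
  then have "norm ((K z - 1) + z * deriv K z) \<le> norm z"
    using Kle norm_triangle_ineq[of "K z - 1" "z * deriv K z"] by (simp add: norm_mult)
  then show "norm (deriv F z - 1) \<le> norm z"
    using z by (simp add: dF algebra_simps)
  show "norm (deriv (deriv F) z) \<le> 1" if "norm z < 1 / 2"
    using norm_twice_add_deriv_le[OF K' K'le that] by (simp add: ddF z)
qed

text \<open>Along the segment from \<open>z\<close> to \<open>w\<close>, the derivative of the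
  remainder is at most \<open>B * (norm (w - z))\<^sup>2 * t\<close>; comparison with the primitive
  of this bound yields the factor 1/2. That factor is matched exactly against the main term in
  \<open>convexity_pos\<close>.\<close>

lemma Taylor_deriv_bound:
  fixes F :: "complex \<Rightarrow> complex"
  assumes S: "convex S" "open S" and F: "F holomorphic_on S"
    and le: "\<And>\<xi>. \<xi> \<in> S \<Longrightarrow> norm (deriv (deriv F) \<xi>) \<le> B"
    and z: "z \<in> S" and w: "w \<in> S"
  shows "norm (F w - F z - deriv F z * (w - z)) \<le> B * (norm (w - z))\<^sup>2 / 2"
proof -
  define \<gamma> where "\<gamma> t = z + of_real t * (w - z)" for t :: real
  have \<gamma>S: "\<gamma> t \<in> S" if "0 \<le> t" "t \<le> 1" for t
    using convexD_alt[OF S(1) z w that]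
    by (simp add: \<gamma>_def scaleR_conv_of_real algebra_simps)
  have F': "deriv F holomorphic_on S"
    using F S(2) by (rule holomorphic_deriv)
  have d\<gamma>: "(\<gamma> has_vector_derivative w - z) (at t within T)" for t T
    unfolding \<gamma>_def by (auto intro!: derivative_eq_intros)
  have dG: "((\<lambda>t. F (\<gamma> t) - of_real t * (deriv F z * (w - z))) has_vector_derivative
      (w - z) * deriv F (\<gamma> t) - deriv F z * (w - z)) (at t)" if "0 \<le> t" "t \<le> 1" for t
  proof -
    have "(F has_field_derivative deriv F (\<gamma> t)) (at (\<gamma> t))"
      using holomorphic_derivI[OF F S(2) \<gamma>S[OF that]] .
    from field_vector_diff_chain_at[OF d\<gamma> this]
    have "((\<lambda>t. F (\<gamma> t)) has_vector_derivative (w - z) * deriv F (\<gamma> t)) (at t)"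
      by (simp add: o_def)
    then show ?thesis by (auto intro!: derivative_eq_intros)
  qed
  have "norm ((F (\<gamma> 1) - of_real 1 * (deriv F z * (w - z))) -
      (F (\<gamma> 0) - of_real 0 * (deriv F z * (w - z))))
    \<le> B * (norm (w - z))\<^sup>2 * 1\<^sup>2 / 2 - B * (norm (w - z))\<^sup>2 * 0\<^sup>2 / 2"
  proof (rule differentiable_bound_general[where
        f' = "\<lambda>t. (w - z) * deriv F (\<gamma> t) - deriv F z * (w - z)"
        and \<phi> = "\<lambda>t. B * (norm (w - z))\<^sup>2 * t\<^sup>2 / 2"
        and \<phi>' = "\<lambda>t. B * (norm (w - z))\<^sup>2 * t"])
    show "continuous_on {0..1} (\<lambda>t. F (\<gamma> t) - of_real t * (deriv F z * (w - z)))"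
      by (rule continuous_on_vector_derivative)
        (use dG in \<open>auto intro: has_vector_derivative_at_within\<close>)
    show "continuous_on {0..1} (\<lambda>t. B * (norm (w - z))\<^sup>2 * t\<^sup>2 / 2)"
      by (intro continuous_intros) auto
    show "((\<lambda>t. F (\<gamma> t) - of_real t * (deriv F z * (w - z))) has_vector_derivative
      (w - z) * deriv F (\<gamma> t) - deriv F z * (w - z)) (at t)" if "0 < t" "t < 1" for t
      using that by (intro dG) auto
    show "((\<lambda>t. B * (norm (w - z))\<^sup>2 * t\<^sup>2 / 2) has_vector_derivative
      B * (norm (w - z))\<^sup>2 * t) (at t)" for t
      by (auto intro!: derivative_eq_intros simp flip: has_real_derivative_iff_has_vector_derivative)
    show "norm ((w - z) * deriv F (\<gamma> t) - deriv F z * (w - z)) \<le> B * (norm (w - z))\<^sup>2 * t"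
      if t: "0 < t" "t < 1" for t
    proof -
      have "norm (deriv F (\<gamma> t) - deriv F z) \<le> B * norm (\<gamma> t - z)"
        by (rule field_differentiable_bound[where S = S and f' = "deriv (deriv F)"])
          (use S z le \<gamma>S t holomorphic_derivI[OF F' S(2)] in auto)
      also have "norm (\<gamma> t - z) = t * norm (w - z)"
        using t by (simp add: \<gamma>_def norm_mult)
      finally have "norm (w - z) * norm (deriv F (\<gamma> t) - deriv F z)
          \<le> norm (w - z) * (B * (t * norm (w - z)))"
        by (intro mult_left_mono) auto
      also have "norm (w - z) * norm (deriv F (\<gamma> t) - deriv F z)
          = norm ((w - z) * deriv F (\<gamma> t) - deriv F z * (w - z))"
        by (simp add: algebra_simps flip: norm_mult)
      finally show ?thesis by (simp add: power2_eq_square algebra_simps)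
    qed
  qed simp
  then show ?thesis by (simp add: \<gamma>_def algebra_simps)
qed

section \<open>Segments in the image of a disk\<close>

text \<open>By \<open>pos\<close>, the modulus of the preimage increases along the segment wherever
  it exceeds \<open>norm z\<^sub>0\<close>. Followed backwards from \<open>f z\<^sub>1\<close>, the
  preimage therefore never leaves the closed disk of radius \<open>norm z\<^sub>1\<close>, whose
  image is compact inside the image of the ball, so the segment cannot exit.\<close>

lemma image_ball_contains_segment:
  fixes f a b :: "complex \<Rightarrow> complex"
  assumes inj: "inj_on f (ball 0 R)"
    and der: "\<And>z. norm z < R \<Longrightarrow> (f has_derivative (\<lambda>v. a z * v + b z * cnj v)) (at z)"
    and jac: "\<And>z. norm z < R \<Longrightarrow> norm (b z) < norm (a z)"
    and pos: "\<And>z. norm z\<^sub>0 < norm z \<Longrightarrow> norm z < R \<Longrightarrow>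
                0 < Re ((z * a z - cnj z * b z) * cnj (f z - f z\<^sub>0))"
    and z1: "norm z\<^sub>0 \<le> norm z\<^sub>1" "norm z\<^sub>1 < R"
  shows "closed_segment (f z\<^sub>0) (f z\<^sub>1) \<subseteq> f ` ball 0 R"
proof (rule ccontr)
  assume not_sub: "\<not> ?thesis"
  define U where "U = f ` ball 0 R"
  define d where "d = f z\<^sub>1 - f z\<^sub>0"
  define W where "W t = f z\<^sub>0 + of_real t * d" for t :: real
  have cont_f: "continuous_on (ball 0 R) f"
    using der by (intro continuous_at_imp_continuous_on ballI has_derivative_continuous) auto
  have "open U"
    unfolding U_def by (intro invariance_of_domain cont_f inj open_ball)
  obtain g where g: "homeomorphism (ball 0 R) U f g"
    using invariance_of_domain_homeomorphism[OF open_ball cont_f _ inj] unfolding U_def by auto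
  have fg: "f (g y) = y" and gU: "norm (g y) < R" and cont_g: "isCont g y" if "y \<in> U" for y
    using g that \<open>open U\<close> unfolding homeomorphism_def
    by (auto simp: continuous_on_eq_continuous_at)
  have gf: "g (f z) = z" if "norm z < R" for z
    using g that unfolding homeomorphism_def by auto
  have cont_W: "continuous_on T W" for T
    unfolding W_def by (intro continuous_intros)
  have W1: "W 1 = f z\<^sub>1" by (simp add: W_def d_def)
  \<comment> \<open>Parameters at which the segment lies outside the image. This set is compact
    because \<open>U\<close> is open, so there is a last such parameter \<open>s\<close>, and
    inverse values exist on all of (s, 1].\<close>
  define T where "T = {0..1} \<inter> W -` (- U)"
  have "compact T"
    unfolding T_def using \<open>open U\<close>
    by (intro compact_Int_closed compact_Icc closed_vimage cont_W) auto
  moreover have "T \<noteq> {}"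
  proof -
    obtain u where "0 \<le> u" "u \<le> 1" "(1 - u) *\<^sub>R f z\<^sub>0 + u *\<^sub>R f z\<^sub>1 \<notin> U"
      using not_sub unfolding U_def closed_segment_def by blast
    moreover have "(1 - u) *\<^sub>R f z\<^sub>0 + u *\<^sub>R f z\<^sub>1 = W u"
      by (simp add: W_def d_def scaleR_conv_of_real algebra_simps)
    ultimately have "u \<in> T" by (simp add: T_def)
    then show ?thesis by blast
  qed
  ultimately obtain s where s: "s \<in> T" and s_max: "\<And>t. t \<in> T \<Longrightarrow> t \<le> s"
    by (metis compact_attains_sup)
  have "W 1 \<in> U" using z1 by (auto simp: W1 U_def)
  with s have s01: "0 \<le> s" "s < 1" by (auto simp: T_def order.order_iff_strict)
  have WU: "W t \<in> U" if "s < t" "t \<le> 1" for t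
    using s_max[of t] that s01 by (force simp: T_def)
  define m where "m t = g (W t) \<bullet> g (W t)" for t
  text \<open>With $z = f^{-1}(W(t))$ and $J = |a|^2 - |b|^2$, the derivative of $|z|^2$ is
    $2\,\mathrm{Re}\,((za - \overline{z}b)\overline{d}) / J$, and $f(z) - f(z_0) = td$.\<close>
  have m_deriv: "\<exists>D>0. (m has_real_derivative D) (at t)"
    if t: "s < t" "t \<le> 1" and big: "norm z\<^sub>0 < norm (g (W t))" for t
  proof -
    define z where "z = g (W t)"
    have z: "norm z < R" "f z = W t"
      using WU[OF t] gU fg by (auto simp: z_def)
    define J where "J = (norm (a z))\<^sup>2 - (norm (b z))\<^sup>2"
    have J: "J > 0"
      unfolding J_def using jac[OF z(1)] by (simp add: power_strict_mono)
    \<comment> \<open>The inverse of the real-linear map taking \<open>v\<close> to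
      \<open>a z * v + b z * cnj v\<close>, whose determinant is \<open>J\<close>.\<close>
    define g' where "g' u = (cnj (a z) * u - b z * cnj u) / of_real J" for u
    have g'_lin: "bounded_linear g'"
      unfolding g'_def
      by (intro bounded_linear_divide[THEN bounded_linear_compose] bounded_linear_sub
          bounded_linear_mult_right bounded_linear_mult_right[THEN bounded_linear_compose]
          bounded_linear_cnj)
    have "g' \<circ> (\<lambda>v. a z * v + b z * cnj v) = id"
    proof
      fix v
      have "cnj (a z) * (a z * v + b z * cnj v) - b z * cnj (a z * v + b z * cnj v)
          = (a z * cnj (a z) - b z * cnj (b z)) * v"
        by (simp add: algebra_simps)
      also have "\<dots> = of_real J * v"
        by (simp add: J_def mult_cnj_eq_norm_square)
      finally show "(g' \<circ> (\<lambda>v. a z * v + b z * cnj v)) v = id v"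
        using J by (simp add: g'_def)
    qed
    moreover have "(f has_derivative (\<lambda>v. a z * v + b z * cnj v)) (at (g (W t)))"
      using der[OF z(1)] unfolding z_def .
    ultimately have "(g has_derivative g') (at (W t))"
      using has_derivative_inverse_basic g'_lin cont_g[OF WU[OF t]] \<open>open U\<close> WU[OF t] fg
      by blast
    moreover have "(W has_derivative (\<lambda>h. of_real h * d)) (at t)"
      unfolding W_def by (auto intro!: derivative_eq_intros)
    ultimately have "((\<lambda>t. g (W t)) has_derivative (\<lambda>h. g' (of_real h * d))) (at t)"
      by (rule has_derivative_compose[rotated])
    then have "(m has_derivative (\<lambda>h. z \<bullet> g' (of_real h * d) + g' (of_real h * d) \<bullet> z)) (at t)"
      unfolding m_def z_def by (intro has_derivative_inner)
    moreover have "g' (of_real h * d) = h *\<^sub>R g' d" for h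
      by (simp add: g'_def scaleR_conv_of_real algebra_simps diff_divide_distrib)
    ultimately have "(m has_derivative (*) (2 * (z \<bullet> g' d))) (at t)"
      by (rule_tac has_derivative_eq_rhs) (auto simp: fun_eq_iff inner_commute)
    then have dm: "(m has_real_derivative 2 * (z \<bullet> g' d)) (at t)"
      by (simp add: has_field_derivative_def)
    \<comment> \<open>The inner product is the real part of \<open>cnj z * g' d\<close>; conjugating
      the first of its two terms leaves \<open>cnj d\<close> as a common factor.\<close>
    have "z \<bullet> g' d = Re ((z * a z - cnj z * b z) * cnj d) / J"
      by (simp add: g'_def inner_complex_def Re_divide_of_real Im_divide_of_real
          diff_divide_distrib add_divide_distrib algebra_simps)
    moreover have "Re ((z * a z - cnj z * b z) * cnj d) > 0"
    proof -
      have "cnj (f z - f z\<^sub>0) = of_real t * cnj d" by (simp add: z W_def)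
      then have "0 < t * Re ((z * a z - cnj z * b z) * cnj d)"
        using pos[of z] big z by (simp add: z_def[symmetric] mult.left_commute[of _ "of_real t"])
      then show ?thesis using t s01 by (simp add: zero_less_mult_iff)
    qed
    ultimately have "0 < 2 * (z \<bullet> g' d)" using J by (simp only: zero_less_divide_iff) simp
    with dm show ?thesis by blast
  qed
  have le: "norm (g (W t)) \<le> norm z\<^sub>1" if t: "s < t" "t \<le> 1" for t
  proof (rule ccontr)
    assume gt: "\<not> ?thesis"
    have cont_gW: "isCont (\<lambda>t. g (W t)) x" if "s < x" "x \<le> 1" for x
      using cont_g[OF WU[OF that]] cont_W[of UNIV]
      by (intro isCont_o2[where f = W and g = g]) (auto simp: continuous_on_eq_continuous_at)
    have "continuous_on {t..1} m"
      unfolding m_def using cont_gW t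
      by (intro continuous_on_inner continuous_at_imp_continuous_on ballI) auto
    \<comment> \<open>A maximum of \<open>m\<close> above the level of \<open>z\<^sub>1\<close>
      cannot sit at 1, where the preimage is \<open>z\<^sub>1\<close> itself, nor to the left of 1,
      where a positive derivative gives larger values further right.\<close>
    then obtain x where x: "x \<in> {t..1}" and x_max: "\<And>y. y \<in> {t..1} \<Longrightarrow> m y \<le> m x"
      using continuous_attains_sup[of "{t..1}" m] t by auto
    have mt: "m y = (norm (g (W y)))\<^sup>2" for y
      by (simp add: m_def power2_norm_eq_inner)
    have "norm (g (W t)) \<le> norm (g (W x))"
      using x_max[of t] t by (simp add: mt)
    with gt have big: "norm z\<^sub>1 < norm (g (W x))" by simp
    then have "x \<noteq> 1" using gf z1 by (auto simp: W1)
    with x have "x < 1" by simp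
    obtain D where "D > 0" "(m has_real_derivative D) (at x)"
      using m_deriv[of x] x t big z1 by auto
    then obtain e where e: "e > 0" "\<And>h. 0 < h \<Longrightarrow> h < e \<Longrightarrow> m x < m (x + h)"
      using DERIV_pos_inc_right by blast
    define h where "h = min (e / 2) (1 - x)"
    have "0 < h" "h < e" "x + h \<le> 1"
      using e(1) \<open>x < 1\<close> by (auto simp: h_def min_def)
    then show False using e(2)[of h] x_max[of "x + h"] x by auto
  qed
  define C where "C = f ` cball 0 (norm z\<^sub>1)"
  have sub: "cball 0 (norm z\<^sub>1) \<subseteq> ball (0::complex) R" using z1 by auto
  have "compact C"
    unfolding C_def by (intro compact_continuous_image continuous_on_subset[OF cont_f sub]) auto
  have WC: "W t \<in> C" if "s < t" "t \<le> 1" for t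
    using le[OF that] fg[OF WU[OF that]] unfolding C_def
    by (intro image_eqI[where x = "g (W t)"]) auto
  \<comment> \<open>Points with parameter just above \<open>s\<close> lie in the closed set
    \<open>C\<close>, hence so does their limit, contradicting that \<open>W s\<close> is outside
    the image.\<close>
  have "W s \<in> C"
  proof (rule Lim_in_closed_set[OF compact_imp_closed[OF \<open>compact C\<close>]])
    show "\<forall>\<^sub>F t in at_right s. W t \<in> C"
      using eventually_at_right_real[OF s01(2)] by eventually_elim (auto intro: WC)
    show "(W \<longlongrightarrow> W s) (at_right s)"
      unfolding W_def by (intro tendsto_intros)
  qed simp
  then have "W s \<in> U" using sub by (auto simp: C_def U_def)
  with s show False by (simp add: T_def)
qed

lemma domain_image_ball:
  fixes f :: "complex \<Rightarrow> complex"
  assumes "continuous_on (ball 0 R) f" "inj_on f (ball 0 R)" "0 < R"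
  shows "domain (f ` ball 0 R)"
  unfolding domain_def
  using assms invariance_of_domain[OF assms(1) open_ball assms(2)]
  by (simp add: connected_continuous_image)

section \<open>Pairs with $|h - zh'| + |g - zg'| \le 1/2$\<close>

text \<open>The hypothesis \<open>half\<close> depends only on moduli, so it is unaffected by
  rotating \<open>g\<close>. Its non-strict form covers every \<open>lam\<close> up to 1/2 at
  once.\<close>

locale Omega_pair =
  fixes h g :: "complex \<Rightarrow> complex"
  assumes h: "h holomorphic_on ball 0 1" and g: "g holomorphic_on ball 0 1"
    and h0: "h 0 = 0" and h'0: "deriv h 0 = 1" and g0: "g 0 = 0" and g'0: "deriv g 0 = 0"
    and half: "norm z < 1 \<Longrightarrow> norm (h z - z * deriv h z) + norm (g z - z * deriv g z) \<le> 1 / 2"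
begin

section \<open>Bounds on sums of moduli from the analytic rotations\<close>

definition F :: "complex \<Rightarrow> complex \<Rightarrow> complex" where
  "F \<epsilon> z = h z + \<epsilon> * g z"

lemma dh: "norm z < 1 \<Longrightarrow> (h has_field_derivative deriv h z) (at z)"
  and dg: "norm z < 1 \<Longrightarrow> (g has_field_derivative deriv g z) (at z)"
  using holomorphic_derivI[OF h open_ball] holomorphic_derivI[OF g open_ball] by auto

lemma F_holomorphic: "F \<epsilon> holomorphic_on ball 0 1"
  unfolding F_def using h g by (intro holomorphic_intros)

lemma deriv_F: "norm z < 1 \<Longrightarrow> deriv (F \<epsilon>) z = deriv h z + \<epsilon> * deriv g z"
  unfolding F_def using dh[of z] dg[of z]
  by (intro DERIV_imp_deriv) (auto intro!: derivative_eq_intros)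

lemma F_half:
  assumes "norm \<epsilon> = 1" "norm z < 1"
  shows "norm (F \<epsilon> z - z * deriv (F \<epsilon>) z) \<le> 1 / 2"
proof -
  have "F \<epsilon> z - z * deriv (F \<epsilon>) z = (h z - z * deriv h z) + \<epsilon> * (g z - z * deriv g z)"
    using assms by (simp add: deriv_F F_def algebra_simps)
  then show ?thesis
    using half[OF assms(2)] norm_triangle_ineq[of "h z - z * deriv h z" "\<epsilon> * (g z - z * deriv g z)"]
    by (simp add: norm_mult assms(1))
qed

lemma F_bounds:
  assumes "norm \<epsilon> = 1" "norm z < 1"
  shows "norm (F \<epsilon> z - z * deriv (F \<epsilon>) z) \<le> (norm z)\<^sup>2 / 2"
    and "norm (F \<epsilon> z - z) \<le> (norm z)\<^sup>2 / 2"
    and "norm (deriv (F \<epsilon>) z - 1) \<le> norm z"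
    and "norm z < 1 / 2 \<Longrightarrow> norm (deriv (deriv (F \<epsilon>)) z) \<le> 1"
  using Omega_analytic_bounds[OF F_holomorphic _ _ F_half[OF assms(1)] assms(2)]
  by (auto simp: deriv_F h'0 g'0) (auto simp: F_def h0 g0)

lemma defect_bound:
  assumes "norm z < 1"
  shows "norm (h z - z * deriv h z) + norm (g z - z * deriv g z) \<le> (norm z)\<^sup>2 / 2"
proof (rule norm_add_le_of_rotations)
  fix \<epsilon> :: complex assume "norm \<epsilon> = 1"
  from F_bounds(1)[OF this assms]
  show "norm (h z - z * deriv h z + \<epsilon> * (g z - z * deriv g z)) \<le> (norm z)\<^sup>2 / 2"
    using assms by (simp add: deriv_F F_def algebra_simps)
qed

lemma value_bound:
  assumes "norm z < 1"
  shows "norm (h z - z) + norm (g z) \<le> (norm z)\<^sup>2 / 2"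
proof (rule norm_add_le_of_rotations)
  fix \<epsilon> :: complex assume "norm \<epsilon> = 1"
  from F_bounds(2)[OF this assms]
  show "norm (h z - z + \<epsilon> * g z) \<le> (norm z)\<^sup>2 / 2"
    by (simp add: F_def algebra_simps)
qed

lemma deriv_bound:
  assumes "norm z < 1"
  shows "norm (deriv h z - 1) + norm (deriv g z) \<le> norm z"
proof (rule norm_add_le_of_rotations)
  fix \<epsilon> :: complex assume "norm \<epsilon> = 1"
  from F_bounds(3)[OF this assms]
  show "norm (deriv h z - 1 + \<epsilon> * deriv g z) \<le> norm z"
    using assms by (simp add: deriv_F algebra_simps)
qed

text \<open>Makes the Jacobian of the harmonic maps positive on the unit disk, and gives the margin
  above 1/2 needed for convexity when |z| < 1/2.\<close>

lemma deriv_gap: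
  assumes "norm z < 1"
  shows "1 - norm z \<le> norm (deriv h z) - norm (deriv g z)"
  using deriv_bound[OF assms] norm_triangle_sub[of 1 "deriv h z"]
  by (simp add: norm_minus_commute)

text \<open>On the closed disk of radius \<open>\<rho>\<close>, each \<open>F \<epsilon>\<close>
  minus the identity has derivative at most \<open>\<rho>\<close> in modulus, so it is a contraction
  there.\<close>

lemma difference_bound:
  assumes "norm z \<le> \<rho>" "norm w \<le> \<rho>" "\<rho> < 1"
  shows "norm (h z - h w - (z - w)) + norm (g z - g w) \<le> \<rho> * norm (z - w)"
proof (rule norm_add_le_of_rotations)
  fix \<epsilon> :: complex assume \<epsilon>: "norm \<epsilon> = 1"
  have "norm ((F \<epsilon> z - z) - (F \<epsilon> w - w)) \<le> \<rho> * norm (z - w)"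
  proof (rule field_differentiable_bound[where S = "cball 0 \<rho>" and f' = "\<lambda>z. deriv (F \<epsilon>) z - 1"])
    fix x assume "x \<in> cball (0::complex) \<rho>"
    then have x: "norm x \<le> \<rho>" "norm x < 1" using assms by auto
    show "((\<lambda>z. F \<epsilon> z - z) has_field_derivative deriv (F \<epsilon>) x - 1) (at x within cball 0 \<rho>)"
      using holomorphic_derivI[OF F_holomorphic open_ball] x
      by (auto intro!: derivative_eq_intros)
    show "norm (deriv (F \<epsilon>) x - 1) \<le> \<rho>"
      using F_bounds(3)[OF \<epsilon> x(2)] x by simp
  qed (use assms in auto)
  then show "norm (h z - h w - (z - w) + \<epsilon> * (g z - g w)) \<le> \<rho> * norm (z - w)"
    by (simp add: F_def algebra_simps)
qed

lemma Taylor_bound: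
  assumes z: "norm z < 1 / 2" and w: "norm w < 1 / 2"
  shows "norm (h w - h z - deriv h z * (w - z)) + norm (g w - g z - deriv g z * (w - z))
           \<le> (norm (w - z))\<^sup>2 / 2"
proof (rule norm_add_le_of_rotations)
  fix \<epsilon> :: complex assume \<epsilon>: "norm \<epsilon> = 1"
  have "norm (F \<epsilon> w - F \<epsilon> z - deriv (F \<epsilon>) z * (w - z)) \<le> 1 * (norm (w - z))\<^sup>2 / 2"
  proof (rule Taylor_deriv_bound[where S = "ball 0 (1 / 2)"])
    show "F \<epsilon> holomorphic_on ball 0 (1 / 2)"
      using F_holomorphic by (rule holomorphic_on_subset) auto
    show "norm (deriv (deriv (F \<epsilon>)) x) \<le> 1" if "x \<in> ball 0 (1 / 2)" for x
      using that by (intro F_bounds(4)[OF \<epsilon>]) auto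
  qed (use assms in auto)
  then show "norm (h w - h z - deriv h z * (w - z) + \<epsilon> * (g w - g z - deriv g z * (w - z)))
      \<le> (norm (w - z))\<^sup>2 / 2"
    using z by (simp add: deriv_F F_def algebra_simps)
qed

section \<open>Injectivity, starlikeness and convexity for one fixed rotation\<close>

context
  fixes \<zeta> :: complex
  assumes \<zeta>: "norm \<zeta> = 1"
begin

definition f :: "complex \<Rightarrow> complex" where
  "f z = h z + \<zeta> * cnj (g z)"

lemma f_has_derivative:
  assumes "norm z < 1"
  shows "(f has_derivative (\<lambda>v. deriv h z * v + (\<zeta> * cnj (deriv g z)) * cnj v)) (at z)"
proof -
  have "(h has_derivative (\<lambda>v. deriv h z * v)) (at z)" "(g has_derivative (\<lambda>v. deriv g z * v)) (at z)"
    using dh[OF assms] dg[OF assms] by (auto simp: has_field_derivative_def)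
  from has_derivative_add[OF this(1) has_derivative_mult_right[OF has_derivative_cnj[OF this(2)], of \<zeta>]]
  show ?thesis unfolding f_def by (simp add: mult.assoc)
qed

lemma continuous_on_f: "continuous_on (ball 0 1) f"
  using f_has_derivative
  by (intro continuous_at_imp_continuous_on ballI has_derivative_continuous) auto

lemma f_0: "f 0 = 0"
  by (simp add: f_def h0 g0)

lemma inj_on_f: "inj_on f (ball 0 1)"
proof (rule inj_onI)
  fix z w :: complex
  assume zw: "z \<in> ball 0 1" "w \<in> ball 0 1" and eq: "f z = f w"
  define \<rho> where "\<rho> = max (norm z) (norm w)"
  have \<rho>: "norm z \<le> \<rho>" "norm w \<le> \<rho>" "\<rho> < 1" using zw by (auto simp: \<rho>_def)
  \<comment> \<open>Equal values force the displacement of the identity to cancel that of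
    \<open>f\<close> minus the identity; the latter is shorter by the factor
    \<open>\<rho>\<close>.\<close>
  have "z - w = - ((h z - h w - (z - w)) + \<zeta> * cnj (g z - g w))"
    using eq by (simp add: f_def algebra_simps)
  then have "norm (z - w) \<le> norm (h z - h w - (z - w)) + norm (\<zeta> * cnj (g z - g w))"
    by (metis norm_minus_cancel norm_triangle_ineq)
  also have "norm (\<zeta> * cnj (g z - g w)) = norm (g z - g w)"
    by (simp add: norm_mult \<zeta> del: complex_cnj_diff)
  also have "norm (h z - h w - (z - w)) + norm (g z - g w) \<le> \<rho> * norm (z - w)"
    using \<rho> by (rule difference_bound)
  finally have "(1 - \<rho>) * norm (z - w) \<le> 0" by (simp add: algebra_simps)
  then have "norm (z - w) \<le> 0"
    using \<rho>(3) by (simp add: mult_le_0_iff)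
  then show "z = w" by simp
qed

lemma jacobian_pos: "norm z < 1 \<Longrightarrow> norm (\<zeta> * cnj (deriv g z)) < norm (deriv h z)"
  using deriv_gap[of z] by (simp add: norm_mult \<zeta>)

lemma univalent_f: "univalent_in_disk 1 f"
  using inj_on_f by (simp add: univalent_in_disk_def)

lemma \<zeta>_cnj: "\<zeta> * cnj \<zeta> = 1"
  by (simp add: mult_cnj_eq_norm_square \<zeta>)

text \<open>Replacing zh' and zg' by h and g turns the real part into |h|^2 - |g|^2. The error is at
  most (|u| + |v|)(|h| + |g|), which is smaller because |u| + |v| is at most |z|^2/2, below |z| -
  |z|^2/2 and hence below |h| - |g|.\<close>

lemma radial_pos:
  assumes z: "z \<noteq> 0" "norm z < 1"
  shows "0 < Re ((z * deriv h z - cnj z * (\<zeta> * cnj (deriv g z))) * cnj (f z))"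
proof -
  define u where "u = h z - z * deriv h z"
  define v where "v = g z - z * deriv g z"
  define x where "x = norm (h z)"
  define y where "y = norm (g z)"
  have uv: "norm u + norm v \<le> (norm z)\<^sup>2 / 2"
    unfolding u_def v_def using z(2) by (rule defect_bound)
  have "norm z - (norm z)\<^sup>2 / 2 \<le> x - y"
    using value_bound[OF z(2)] norm_triangle_sub[of z "h z"]
    by (simp add: x_def y_def norm_minus_commute)
  moreover have "(norm z)\<^sup>2 < norm z"
    using z by (simp add: power2_eq_square)
  ultimately have gap: "norm u + norm v < x - y" using uv by linarith
  have f_le: "norm (f z) \<le> x + y"
    unfolding f_def x_def y_def by (rule norm_triangle_le) (simp add: norm_mult \<zeta>)
  have "z * deriv h z - cnj z * (\<zeta> * cnj (deriv g z))
      = (h z - \<zeta> * cnj (g z)) - (u - \<zeta> * cnj v)"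
    by (simp add: u_def v_def algebra_simps)
  then have eq: "Re ((z * deriv h z - cnj z * (\<zeta> * cnj (deriv g z))) * cnj (f z))
      = Re ((h z - \<zeta> * cnj (g z)) * cnj (f z)) - Re ((u - \<zeta> * cnj v) * cnj (f z))"
    by (simp only: left_diff_distrib minus_complex.sel)
  \<comment> \<open>The mixed terms form a number minus its conjugate and drop out of the real
    part.\<close>
  have "(h z - \<zeta> * cnj (g z)) * cnj (f z)
      = h z * cnj (h z) - (\<zeta> * cnj \<zeta>) * (g z * cnj (g z))
        + (cnj \<zeta> * h z * g z - cnj (cnj \<zeta> * h z * g z))"
    by (simp add: f_def algebra_simps)
  then have "Re ((h z - \<zeta> * cnj (g z)) * cnj (f z)) = x\<^sup>2 - y\<^sup>2"
    by (simp only: \<zeta>_cnj mult_cnj_eq_norm_square x_def y_def)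
      (simp add: \<zeta> algebra_simps flip: of_real_power)
  moreover have "Re ((u - \<zeta> * cnj v) * cnj (f z)) \<le> (norm u + norm v) * (x + y)"
  proof -
    have "Re ((u - \<zeta> * cnj v) * cnj (f z)) \<le> norm (u - \<zeta> * cnj v) * norm (f z)"
      by (metis complex_Re_le_cmod complex_mod_cnj norm_mult)
    also have "\<dots> \<le> (norm u + norm v) * (x + y)"
      using f_le norm_triangle_ineq4[of u "\<zeta> * cnj v"]
      by (intro mult_mono) (auto simp: norm_mult \<zeta>)
    finally show ?thesis .
  qed
  moreover have "(norm u + norm v) * (x + y) < (x - y) * (x + y)"
    using gap norm_ge_zero[of u] norm_ge_zero[of v] norm_ge_zero[of "g z"] unfolding y_def
    by (intro mult_strict_right_mono) linarith+
  ultimately show ?thesis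
    unfolding eq by (simp add: power2_eq_square algebra_simps)
qed

lemma starlike_f: "starlike_in_disk 1 f"
  unfolding starlike_in_disk_def
proof (intro conjI ballI)
  show "domain (f ` ball 0 1)"
    by (rule domain_image_ball[OF continuous_on_f inj_on_f]) simp
  show "0 \<in> f ` ball 0 1"
    by (rule image_eqI[where x = 0]) (auto simp: f_0)
  fix w assume "w \<in> f ` ball 0 1"
  then obtain z where z: "w = f z" "norm z < 1" by auto
  have "closed_segment (f 0) (f z) \<subseteq> f ` ball 0 1"
    by (rule image_ball_contains_segment[OF inj_on_f f_has_derivative jacobian_pos])
      (use z radial_pos in \<open>auto simp: f_0\<close>)
  then show "closed_segment 0 w \<subseteq> f ` ball 0 1" by (simp add: z f_0)
qed

text \<open>Expanding f(w) to first order at \<open>z\<close> leaves a main term of at least (|a|^2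
  - |b|^2)|\<delta>|^2/2 and an error of at most |z|(|a| + |b|)|\<delta>|^2/2. What remains is |a| -
  |b| > |z|; since |a| - |b| is at least 1 - |z|, the radius 1/2 is exactly where this argument
  stops.\<close>

lemma convexity_pos:
  assumes wz: "norm w < norm z" and z: "norm z < 1 / 2"
  shows "0 < Re ((z * deriv h z - cnj z * (\<zeta> * cnj (deriv g z))) * cnj (f z - f w))"
proof -
  define a where "a = deriv h z"
  define b where "b = \<zeta> * cnj (deriv g z)"
  define \<delta> where "\<delta> = z - w"
  define r\<^sub>1 where "r\<^sub>1 = h w - h z - deriv h z * (w - z)"
  define r\<^sub>2 where "r\<^sub>2 = g w - g z - deriv g z * (w - z)"
  define R where "R = r\<^sub>1 + \<zeta> * cnj r\<^sub>2"
  have nb: "norm b = norm (deriv g z)" by (simp add: b_def norm_mult \<zeta>)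
  have ab: "1 / 2 < norm a - norm b"
    using deriv_gap[of z] z by (simp add: nb a_def)
  have "norm R \<le> norm r\<^sub>1 + norm r\<^sub>2"
    unfolding R_def by (rule norm_triangle_le) (simp add: norm_mult \<zeta>)
  also have "\<dots> \<le> (norm \<delta>)\<^sup>2 / 2"
    unfolding r\<^sub>1_def r\<^sub>2_def \<delta>_def using Taylor_bound[of z w] wz z by (simp add: norm_minus_commute)
  finally have R: "norm R \<le> (norm \<delta>)\<^sup>2 / 2" .
  have \<delta>: "norm \<delta> > 0" using wz by (auto simp: \<delta>_def)
  have "f z - f w = a * \<delta> + b * cnj \<delta> - R"
    by (simp add: f_def a_def b_def \<delta>_def R_def r\<^sub>1_def r\<^sub>2_def algebra_simps)
  then have eq: "Re ((z * a - cnj z * b) * cnj (f z - f w))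
      = Re ((z * a - cnj z * b) * cnj (a * \<delta> + b * cnj \<delta>)) - Re ((z * a - cnj z * b) * cnj R)"
    by (simp only: complex_cnj_diff right_diff_distrib minus_complex.sel)
  \<comment> \<open>Again the mixed terms are a number minus its conjugate.\<close>
  have "(z * a - cnj z * b) * cnj (a * \<delta> + b * cnj \<delta>)
      = (a * cnj a) * (z * cnj \<delta>) - (b * cnj b) * cnj (z * cnj \<delta>)
        + (z * a * cnj b * \<delta> - cnj (z * a * cnj b * \<delta>))"
    by (simp add: algebra_simps)
  then have main: "Re ((z * a - cnj z * b) * cnj (a * \<delta> + b * cnj \<delta>))
      = ((norm a)\<^sup>2 - (norm b)\<^sup>2) * Re (z * cnj \<delta>)"
    by (simp only: mult_cnj_eq_norm_square) (simp add: algebra_simps flip: of_real_power)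
  text \<open>This second-order lower bound absorbs the Taylor remainder $R$ even as $w$ tends
    to $z$ tangentially to the circle of radius $|z|$.\<close>
  have "(norm z)\<^sup>2 - (norm w)\<^sup>2 + (norm \<delta>)\<^sup>2 = 2 * Re (z * cnj \<delta>)"
    by (simp add: \<delta>_def cmod_power2) (simp add: power2_eq_square algebra_simps)
  moreover have "(norm w)\<^sup>2 < (norm z)\<^sup>2" using wz by (simp add: power_strict_mono)
  ultimately have "(norm \<delta>)\<^sup>2 / 2 \<le> Re (z * cnj \<delta>)" by simp
  moreover have "0 \<le> (norm a)\<^sup>2 - (norm b)\<^sup>2"
    using ab by (simp add: power_mono)
  ultimately have "((norm a)\<^sup>2 - (norm b)\<^sup>2) * ((norm \<delta>)\<^sup>2 / 2)
      \<le> Re ((z * a - cnj z * b) * cnj (a * \<delta> + b * cnj \<delta>))"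
    unfolding main by (rule mult_left_mono)
  moreover have "Re ((z * a - cnj z * b) * cnj R)
      \<le> (1 / 2 * (norm a + norm b)) * ((norm \<delta>)\<^sup>2 / 2)"
  proof -
    have "Re ((z * a - cnj z * b) * cnj R) \<le> norm (z * a - cnj z * b) * norm R"
      by (metis complex_Re_le_cmod complex_mod_cnj norm_mult)
    also have "\<dots> \<le> (1 / 2 * (norm a + norm b)) * ((norm \<delta>)\<^sup>2 / 2)"
    proof (rule mult_mono[OF _ R])
      have "norm (z * a - cnj z * b) \<le> norm z * (norm a + norm b)"
        using norm_triangle_ineq4[of "z * a" "cnj z * b"] by (simp add: norm_mult algebra_simps)
      also have "\<dots> \<le> 1 / 2 * (norm a + norm b)"
        using z by (intro mult_right_mono) auto
      finally show "norm (z * a - cnj z * b) \<le> 1 / 2 * (norm a + norm b)" .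
    qed auto
    finally show ?thesis .
  qed
  moreover have "(1 / 2 * (norm a + norm b)) * ((norm \<delta>)\<^sup>2 / 2)
      < ((norm a)\<^sup>2 - (norm b)\<^sup>2) * ((norm \<delta>)\<^sup>2 / 2)"
  proof (rule mult_strict_right_mono)
    have "1 / 2 * (norm a + norm b) < (norm a - norm b) * (norm a + norm b)"
      using ab norm_ge_zero[of b] by (intro mult_strict_right_mono) linarith+
    then show "1 / 2 * (norm a + norm b) < (norm a)\<^sup>2 - (norm b)\<^sup>2"
      by (simp add: power2_eq_square algebra_simps)
  qed (use \<delta> in simp)
  ultimately have "0 < Re ((z * a - cnj z * b) * cnj (f z - f w))"
    unfolding eq by linarith
  then show ?thesis by (simp only: a_def b_def)
qed

lemma convex_f: "convex_in_disk (1 / 2) f"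
  unfolding convex_in_disk_def
proof
  have sub: "ball 0 (1 / 2) \<subseteq> ball (0::complex) 1" by auto
  have inj: "inj_on f (ball 0 (1 / 2))"
    using inj_on_f sub by (rule inj_on_subset)
  show "domain (f ` ball 0 (1 / 2))"
    by (rule domain_image_ball[OF continuous_on_subset[OF continuous_on_f sub] inj]) simp
  have seg: "closed_segment (f w) (f z) \<subseteq> f ` ball 0 (1 / 2)"
    if "norm w \<le> norm z" "norm z < 1 / 2" for w z
    by (rule image_ball_contains_segment[OF inj f_has_derivative jacobian_pos])
      (use that convexity_pos in auto)
  \<comment> \<open>The positivity condition treats the endpoint of smaller modulus as the base
    point; the other order follows by reversing the segment.\<close>
  have "closed_segment (f w) (f z) \<subseteq> f ` ball 0 (1 / 2)"
    if "norm w < 1 / 2" "norm z < 1 / 2" for w z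
    using seg[of w z] seg[of z w] that by (cases "norm w \<le> norm z") (auto simp: closed_segment_commute)
  then show "convex (f ` ball 0 (1 / 2))"
    unfolding convex_contains_segment by auto
qed

end
end

section \<open>The normalised decomposition\<close>

text \<open>A series starting at degree 2 is z^2 times a power series \<open>k\<close> that is
  differentiable at 0, so its value and derivative vanish there.\<close>

lemma H0_decomp_at_0:
  assumes "H0_decomp f h g"
  shows "h 0 = 0" "deriv h 0 = 1" "g 0 = 0" "deriv g 0 = 0"
proof -
  have aux: "u 0 = 0 \<and> deriv u 0 = 0"
    if sums: "\<forall>z\<in>ball 0 1. (\<lambda>n. c (n + 2) * z ^ (n + 2)) sums u z" for u c :: "_ \<Rightarrow> complex"
  proof -
    define k where "k z = (\<Sum>n. c (n + 2) * z ^ n)" for z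
    have u: "u z = z\<^sup>2 * k z" if "norm z < 1" for z
    proof (cases "z = 0")
      case False
      have "(\<lambda>n. c (n + 2) * z ^ (n + 2) / z\<^sup>2) sums (u z / z\<^sup>2)"
        using sums that by (intro sums_divide) auto
      then have "(\<lambda>n. c (n + 2) * z ^ n) sums (u z / z\<^sup>2)"
        using False by (simp add: power_add power2_eq_square)
      then show ?thesis using False by (simp add: k_def sums_iff)
    next
      case True
      have "(\<lambda>n. c (n + 2) * 0 ^ (n + 2)) sums u 0" using sums by (rule bspec) simp
      then have "(\<lambda>n. 0) sums u 0" by simp
      then show ?thesis using True sums_unique2[OF sums_zero] by auto
    qed
    \<comment> \<open>Convergence at the single point 1/2 makes the radius of convergence of
      \<open>k\<close> positive, which is enough for differentiability at 0.\<close>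
    have "(\<lambda>n. c (n + 2) * (1 / 2) ^ (n + 2)) sums u (1 / 2)"
      by (rule bspec[OF sums]) (simp add: norm_divide)
    then have "summable (\<lambda>n. c (n + 2) * (1 / 2) ^ (n + 2) / (1 / 2)\<^sup>2)"
      by (intro summable_divide) (rule sums_summable)
    then have "summable (\<lambda>n. c (n + 2) * (1 / 2) ^ n)"
      by (simp add: power_add)
    from termdiffs_strong[OF this, of 0]
    obtain k' where k': "(k has_field_derivative k') (at 0)"
      unfolding k_def by (auto simp: norm_divide)
    have "(u has_field_derivative 0) (at 0)"
    proof (rule has_field_derivative_transform_within_open[where S = "ball 0 1"])
      show "((\<lambda>z. z\<^sup>2 * k z) has_field_derivative 0) (at 0)"
        using k' by (auto intro!: derivative_eq_intros)
    qed (use u in auto)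
    then show ?thesis using u[of 0] by (simp add: DERIV_imp_deriv)
  qed
  obtain a b where a: "\<forall>z\<in>ball 0 1. (\<lambda>n. a (n + 2) * z ^ (n + 2)) sums (h z - z)"
    and b: "\<forall>z\<in>ball 0 1. (\<lambda>n. b (n + 2) * z ^ (n + 2)) sums g z"
    and hol: "h holomorphic_on ball 0 1"
    using assms unfolding H0_decomp_def by blast
  show "g 0 = 0" "deriv g 0 = 0" using aux[OF b] by auto
  show "h 0 = 0" using aux[OF a] by auto
  have "deriv (\<lambda>z. h z - z) 0 = deriv h 0 - 1"
    using holomorphic_derivI[OF hol open_ball, of 0]
    by (intro DERIV_imp_deriv) (auto intro!: derivative_eq_intros)
  then show "deriv h 0 = 1" using aux[OF a] by simp
qed

text \<open>The difference of the analytic parts equals the conjugate of a holomorphic function, so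
  its derivative is both complex-linear and conjugate-linear and must vanish. The normalisation at 0
  fixes the remaining constant.\<close>

lemma H0_decomp_unique:
  assumes d1: "H0_decomp f h g" and d2: "H0_decomp f h' g'" and z: "norm z < 1"
  shows "h z = h' z" "g z = g' z"
proof -
  define D where "D z = h z - h' z" for z
  define E where "E z = g' z - g z" for z
  have hol: "D holomorphic_on ball 0 1" "E holomorphic_on ball 0 1"
    using d1 d2 unfolding D_def E_def H0_decomp_def by (auto intro: holomorphic_intros)
  have D_eq: "D z = cnj (E z)" if "norm z < 1" for z
  proof -
    have "h z + cnj (g z) = h' z + cnj (g' z)"
      using d1 d2 that unfolding H0_decomp_def by (metis mem_ball_0)
    then show ?thesis by (simp add: D_def E_def algebra_simps)
  qed
  have "(D has_field_derivative 0) (at z)" if z: "z \<in> ball 0 1" for z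
  proof -
    have D': "(D has_derivative (\<lambda>v. deriv D z * v)) (at z)"
      and E': "(E has_derivative (\<lambda>v. deriv E z * v)) (at z)"
      using hol[THEN holomorphic_derivI, OF open_ball z] by (auto simp: has_field_derivative_def)
    have "(D has_derivative (\<lambda>v. cnj (deriv E z * v))) (at z)"
      using has_derivative_cnj[OF E']
      by (rule has_derivative_transform_within_open[where s = "ball 0 1"]) (use z D_eq in auto)
    from has_derivative_unique[OF D' this] have eq: "deriv D z * v = cnj (deriv E z * v)" for v
      by (simp add: fun_eq_iff)
    \<comment> \<open>Testing with 1 and \<open>\<i>\<close> gives \<open>deriv D z\<close> equal to
      both the conjugate of \<open>deriv E z\<close> and its negative.\<close>
    have "deriv D z = 0" using eq[of 1] eq[of \<i>] by (simp add: complex_eq_iff)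
    then show ?thesis using holomorphic_derivI[OF hol(1) open_ball z] by simp
  qed
  then obtain c where c: "\<And>z. z \<in> ball 0 1 \<Longrightarrow> D z = c"
    using has_field_derivative_zero_constant[of "ball 0 1" D]
    by (meson convex_ball has_field_derivative_at_within)
  have "D 0 = 0" using H0_decomp_at_0(1)[OF d1] H0_decomp_at_0(1)[OF d2] by (simp add: D_def)
  then have "D z = 0" using c[of 0] c[of z] z by simp
  moreover from this have "E z = 0" using D_eq[OF z] by simp
  ultimately show "h z = h' z" "g z = g' z" by (simp_all add: D_def E_def)
qed

text \<open>Membership in \<open>Omega_H0\<close> gives the inequality for some decomposition;
  uniqueness moves it to the given \<open>h\<close> and \<open>g\<close>. Derivatives agree because
  the functions agree on a neighbourhood of each point.\<close>

lemma Omega_pair_of_Omega_H0: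
  assumes lam: "lam \<le> 1 / 2" and d: "H0_decomp f h g" and f: "f \<in> Omega_H0 lam"
  shows "Omega_pair h g"
proof
  show "h holomorphic_on ball 0 1" "g holomorphic_on ball 0 1"
    using d by (auto simp: H0_decomp_def)
  show "h 0 = 0" "deriv h 0 = 1" "g 0 = 0" "deriv g 0 = 0"
    using H0_decomp_at_0[OF d] by auto
  fix z :: complex assume z: "norm z < 1"
  obtain h' g' where d': "H0_decomp f h' g'"
    and le: "\<And>z. z \<in> ball 0 1 \<Longrightarrow>
      norm (h' z - z * deriv h' z) < lam - norm (g' z - z * deriv g' z)"
    using f unfolding Omega_H0_def by blast
  have "\<forall>\<^sub>F w in nhds z. w \<in> ball 0 1"
    using z by (intro eventually_nhds_in_open) auto
  then have "\<forall>\<^sub>F w in nhds z. h w = h' w" "\<forall>\<^sub>F w in nhds z. g w = g' w"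
    using H0_decomp_unique[OF d d'] by (auto elim!: eventually_mono)
  then have "deriv h z = deriv h' z" "deriv g z = deriv g' z"
    by (auto intro: deriv_cong_ev)
  then show "norm (h z - z * deriv h z) + norm (g z - z * deriv g z) \<le> 1 / 2"
    using le[of z] lam z H0_decomp_unique[OF d d' z] by simp
qed

theorem corollary2p3:
  fixes lam :: real and f h g :: "complex \<Rightarrow> complex"
  assumes "0 < lam" and "lam \<le> 1 / 2"
    and "H0_decomp f h g" and "f \<in> Omega_H0 lam"
  shows "(stable_harmonic (univalent_in_disk 1) h g \<and>
          stable_harmonic (starlike_in_disk 1) h g \<and>
          stable_harmonic (convex_in_disk (1 / 2)) h g) \<and>
         (univalent_in_disk 1 f \<and> starlike_in_disk 1 f \<and> convex_in_disk (1 / 2) f)"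
proof -
  interpret Omega_pair h g
    using assms(2-4) by (rule Omega_pair_of_Omega_H0)
  \<comment> \<open>Here \<open>local.f\<close> is the rotated function of the locale context,
    distinct from the \<open>f\<close> of the statement.\<close>
  have f_eq: "local.f \<zeta> = (\<lambda>z. h z + \<zeta> * cnj (g z))" if "norm \<zeta> = 1" for \<zeta>
    using that by (simp add: f_def fun_eq_iff)
  have stable: "stable_harmonic (univalent_in_disk 1) h g"
    "stable_harmonic (starlike_in_disk 1) h g"
    "stable_harmonic (convex_in_disk (1 / 2)) h g"
    unfolding stable_harmonic_def using univalent_f starlike_f convex_f f_eq by metis+
  \<comment> \<open>The unrotated claims are the case of rotation 1. Since \<open>f\<close> is
    prescribed only on the unit disk, they pass to it through equality of values and images
    there.\<close>
  have eq: "h z + 1 * cnj (g z) = f z" if "z \<in> ball 0 1" for z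
    using assms(3) that by (simp add: H0_decomp_def)
  have img: "(\<lambda>z. h z + 1 * cnj (g z)) ` ball 0 r = f ` ball 0 r" if "r \<le> 1" for r
    using that by (intro image_cong eq) auto
  have "univalent_in_disk 1 (\<lambda>z. h z + 1 * cnj (g z))"
    "starlike_in_disk 1 (\<lambda>z. h z + 1 * cnj (g z))"
    "convex_in_disk (1 / 2) (\<lambda>z. h z + 1 * cnj (g z))"
    using stable unfolding stable_harmonic_def by (metis norm_one)+
  moreover have "inj_on (\<lambda>z. h z + 1 * cnj (g z)) (ball 0 1) \<longleftrightarrow> inj_on f (ball 0 1)"
    using eq by (rule inj_on_cong)
  ultimately have "univalent_in_disk 1 f \<and> starlike_in_disk 1 f \<and> convex_in_disk (1 / 2) f"
    unfolding univalent_in_disk_def starlike_in_disk_def convex_in_disk_def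
    by (simp only: img[OF order.refl] img[of "1 / 2"] simp_thms) (simp add: img[of "1 / 2", simplified])
  with stable show ?thesis by blast
qed

end
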